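(* Let $V$ be a finite set and let $f_1, f_2 : 2^V \to \mathbb{R}$ be monotone non-decreasing submodular set functions. Then the set function $g : 2^V \to \mathbb{R}$ defined by $g(A) = \min\{f_1(A), f_2(V\setminus A)\}$ is submodular.
   Context: A set function $f:2^V\to\mathbb{R}$ is submodular if $f(S)+f(T)\ge f(S\cup T)+f(S\cap T)$ for all $S,T\subseteq V$, and monotone non-decreasing if $f(S)\le f(T)$ whenever $S\subseteq T$. *)

theory Defs
  imports Complex_Main
begin

definition submodular_on :: "'a set \<Rightarrow> ('a set \<Rightarrow> real) \<Rightarrow> bool" where
  "submodular_on V f \<longleftrightarrow>
     (\<forall>S T. S \<subseteq> V \<longrightarrow> T \<subseteq> V \<longrightarrow> f S + f T \<ge> f (S \<union> T) + f (S \<inter> T))"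

end

theory Submission
  imports Defs
begin

text \<open>By De Morgan, complementation in \<open>V\<close> exchanges union and intersection, and
  the submodular inequality is symmetric in these two.\<close>

lemma submodular_on_complement:
  assumes "submodular_on V f"
  shows "submodular_on V (\<lambda>A. f (V - A))"
  unfolding submodular_on_def
proof (intro allI impI)
  fix S T
  have "f (V - S) + f (V - T) \<ge> f ((V - S) \<union> (V - T)) + f ((V - S) \<inter> (V - T))"
    using assms by (simp add: submodular_on_def)
  then show "f (V - S) + f (V - T) \<ge> f (V - (S \<union> T)) + f (V - (S \<inter> T))"
    by (simp add: Diff_Un Diff_Int)
qed

text \<open>If the minimum is attained by the same function at \<open>S\<close> and \<open>T\<close>, submodularity of that
  function suffices. If it is attained by \<open>f\<close> at \<open>S\<close> and by \<open>h\<close> at \<open>T\<close>, monotonicity alone does: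
  \<open>f (S \<inter> T) \<le> f S\<close> and \<open>h (S \<union> T) \<le> h T\<close>.\<close>

lemma submodular_on_min_mono_antimono:
  fixes f h :: "'a set \<Rightarrow> real"
  assumes f: "mono_on (Pow V) f" "submodular_on V f"
    and h: "antimono_on (Pow V) h" "submodular_on V h"
  shows "submodular_on V (\<lambda>A. min (f A) (h A))"
  unfolding submodular_on_def
proof (intro allI impI)
  fix S T assume "S \<subseteq> V" "T \<subseteq> V"
  then have "S \<inter> T \<subseteq> V" by blast
  with \<open>S \<subseteq> V\<close> \<open>T \<subseteq> V\<close>
  have "f (S \<inter> T) \<le> f S" "f (S \<inter> T) \<le> f T" "h (S \<union> T) \<le> h S" "h (S \<union> T) \<le> h T"
    using monotone_onD[OF f(1), of "S \<inter> T"] monotone_onD[OF h(1), of _ "S \<union> T"] by auto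
  moreover have "f S + f T \<ge> f (S \<union> T) + f (S \<inter> T)" "h S + h T \<ge> h (S \<union> T) + h (S \<inter> T)"
    using f(2) h(2) \<open>S \<subseteq> V\<close> \<open>T \<subseteq> V\<close> by (auto simp: submodular_on_def)
  \<comment> \<open>Each minimum on the right is at most either of its arguments, so every case
    picks the one it needs.\<close>
  ultimately show "min (f S) (h S) + min (f T) (h T)
      \<ge> min (f (S \<union> T)) (h (S \<union> T)) + min (f (S \<inter> T)) (h (S \<inter> T))"
    by linarith
qed

theorem theorem1:
  fixes V :: "'a set" and f1 f2 :: "'a set \<Rightarrow> real"
  assumes "finite V"
    and "mono_on (Pow V) f1" and "submodular_on V f1"
    and "mono_on (Pow V) f2" and "submodular_on V f2"
  shows "submodular_on V (\<lambda>A. min (f1 A) (f2 (V - A)))"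
\<comment> \<open>Here \<open>h A = f2 (V - A)\<close>: complementation reverses inclusion, which
  makes \<open>h\<close> antitone, and preserves submodularity.\<close>
proof (rule submodular_on_min_mono_antimono)
  show "antimono_on (Pow V) (\<lambda>A. f2 (V - A))"
  proof (rule monotone_onI)
    fix A B :: "'a set" assume "A \<subseteq> B"
    then have "V - B \<subseteq> V - A" by blast
    then show "f2 (V - A) \<ge> f2 (V - B)"
      using monotone_onD[OF assms(4), of "V - B" "V - A"] by auto
  qed
qed (use assms submodular_on_complement in auto)

end
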